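(* Let $(L,[\cdot,\cdot],\zeta,\varepsilon)$ be a Hom-Lie color algebra graded by the abelian group $\Gamma$. Let $\sigma:\Gamma\times\Gamma\to\mathbb{F}^*$ be a multiplier on $\Gamma$ and let $\delta$ be the bi-character on $\Gamma$ associated with $\sigma$. Then $(L^\sigma,[\cdot,\cdot]^\sigma,\zeta,\varepsilon\delta)$ is a Hom-Lie color algebra, where $\varepsilon\delta(\alpha,\beta)=\varepsilon(\alpha,\beta)\delta(\alpha,\beta)$.
   Context: Throughout, $\mathbb{F}$ is a field of characteristic zero, $\Gamma$ is an abelian group (written additively), and all vector spaces are over $\mathbb{F}$. A $\Gamma$-graded vector space is $V=\bigoplus_{\alpha\in\Gamma}V_\alpha$; $\bar x\in\Gamma$ denotes the degree of a homogeneous element $x$. A linear map is even if it preserves degrees; a bilinear product on $V$ is even if it maps $V_\alpha\times V_\beta$ into $V_{\alpha+\beta}$. A bi-character on $\Gamma$ is a map $\varepsilon:\Gamma\times\Gamma\to\mathbb{F}^*$ with $\varepsilon(\alpha,\beta)\varepsilon(\beta,\alpha)=1$, $\varepsilon(\alpha,\beta+\gamma)=\varepsilon(\alpha,\beta)\varepsilon(\alpha,\gamma)$, $\varepsilon(\alpha+\beta,\gamma)=\varepsilon(\alpha,\gamma)\varepsilon(\beta,\gamma)$. For homogeneous $x,y$ write $\varepsilon(x,y)=\varepsilon(\bar x,\bar y)$ and $\sigma(x,y)=\sigma(\bar x,\bar y)$. The symbol $\circlearrowleft_{x,y,z}$ denotes summation over the cyclic permutations of $x,y,z$. A Hom-Lie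 color algebra $(L,[\cdot,\cdot],\zeta,\varepsilon)$ consists of a $\Gamma$-graded space $L$, an even bilinear map $[\cdot,\cdot]:L\times L\to L$, an (even) algebra homomorphism $\zeta:L\to L$ (i.e. $\zeta([x,y])=[\zeta(x),\zeta(y)]$), and a bi-character $\varepsilon$ on $\Gamma$, such that for all homogeneous $x,y,z\in L$: $[x,y]=-\varepsilon(x,y)[y,x]$ and $\circlearrowleft_{x,y,z}\varepsilon(z,x)[\zeta(x),[y,z]]=0$. For a map $\sigma:\Gamma\times\Gamma\to\mathbb{F}^*$, the $\sigma$-twist $L^\sigma$ of $L$ is the $\Gamma$-graded vector space $L$ with the bilinear multiplication determined by $[x,y]^\sigma=\sigma(x,y)[x,y]$ for homogeneous $x,y\in L$. The map $\sigma$ is called a multiplier on $\Gamma$ if $\sigma(\alpha,\beta+\gamma)\sigma(\beta,\gamma)=\sigma(\alpha,\beta)\sigma(\alpha+\beta,\gamma)$ for all $\alpha,\beta,\gamma\in\Gamma$. The bi-character associated with a multiplier $\sigma$ is $\delta(\alpha,\beta)=\sigma(\alpha,\beta)\sigma(\beta,\alpha)^{-1}$ (it is known that this is indeed a bi-character on $\Gamma$). *)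

theory Defs
  imports Complex_Main
begin

section \<open>Graded vector spaces\<close>

definition homogeneous_decomposition ::
    "('g \<Rightarrow> 'v::ab_group_add set) \<Rightarrow> 'v \<Rightarrow> ('g \<Rightarrow> 'v) \<Rightarrow> bool" where
  "homogeneous_decomposition V x c \<longleftrightarrow>
     (\<forall>\<alpha>. c \<alpha> \<in> V \<alpha>) \<and> finite {\<alpha>. c \<alpha> \<noteq> 0} \<and> x = (\<Sum>\<alpha> | c \<alpha> \<noteq> 0. c \<alpha>)"

text \<open>The space is the whole type \<open>'v\<close>, and \<open>V \<alpha>\<close> is its subspace of elements of degree \<open>\<alpha>\<close>;
  \<open>0\<close> belongs to every \<open>V \<alpha>\<close>.\<close>

locale graded_vector_space = vector_space scale
  for scale :: "'f::field_char_0 \<Rightarrow> 'v::ab_group_add \<Rightarrow> 'v" +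
  fixes V :: "'g::ab_group_add \<Rightarrow> 'v set"
  assumes subspace_degree: "subspace (V \<alpha>)"
    and direct_sum: "\<exists>!c. homogeneous_decomposition V x c"

definition homogeneous_component ::
    "('g \<Rightarrow> 'v::ab_group_add set) \<Rightarrow> 'v \<Rightarrow> 'g \<Rightarrow> 'v" where
  "homogeneous_component V x = (THE c. homogeneous_decomposition V x c)"

definition homogeneous_support :: "('g \<Rightarrow> 'v::ab_group_add set) \<Rightarrow> 'v \<Rightarrow> 'g set" where
  "homogeneous_support V x = {\<alpha>. homogeneous_component V x \<alpha> \<noteq> 0}"


section \<open>Bi-characters and multipliers\<close>

definition bicharacter :: "('g::ab_group_add \<Rightarrow> 'g \<Rightarrow> 'f::field) \<Rightarrow> bool" where
  "bicharacter \<epsilon> \<longleftrightarrow>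
     (\<forall>\<alpha> \<beta>. \<epsilon> \<alpha> \<beta> \<noteq> 0) \<and>
     (\<forall>\<alpha> \<beta>. \<epsilon> \<alpha> \<beta> * \<epsilon> \<beta> \<alpha> = 1) \<and>
     (\<forall>\<alpha> \<beta> \<gamma>. \<epsilon> \<alpha> (\<beta> + \<gamma>) = \<epsilon> \<alpha> \<beta> * \<epsilon> \<alpha> \<gamma>) \<and>
     (\<forall>\<alpha> \<beta> \<gamma>. \<epsilon> (\<alpha> + \<beta>) \<gamma> = \<epsilon> \<alpha> \<gamma> * \<epsilon> \<beta> \<gamma>)"

definition multiplier :: "('g::ab_group_add \<Rightarrow> 'g \<Rightarrow> 'f::field) \<Rightarrow> bool" where
  "multiplier \<sigma> \<longleftrightarrow>
     (\<forall>\<alpha> \<beta>. \<sigma> \<alpha> \<beta> \<noteq> 0) \<and>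
     (\<forall>\<alpha> \<beta> \<gamma>. \<sigma> \<alpha> (\<beta> + \<gamma>) * \<sigma> \<beta> \<gamma> = \<sigma> \<alpha> \<beta> * \<sigma> (\<alpha> + \<beta>) \<gamma>)"

definition associated_bicharacter :: "('g \<Rightarrow> 'g \<Rightarrow> 'f::field) \<Rightarrow> 'g \<Rightarrow> 'g \<Rightarrow> 'f" where
  "associated_bicharacter \<sigma> \<alpha> \<beta> = \<sigma> \<alpha> \<beta> * inverse (\<sigma> \<beta> \<alpha>)"


section \<open>Hom-Lie color algebras and their twists\<close>

locale hom_lie_color_algebra = graded_vector_space scale V
  for scale :: "'f::field_char_0 \<Rightarrow> 'v::ab_group_add \<Rightarrow> 'v"
    and V :: "'g::ab_group_add \<Rightarrow> 'v set" +
  fixes bracket :: "'v \<Rightarrow> 'v \<Rightarrow> 'v"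
    and \<zeta> :: "'v \<Rightarrow> 'v"
    and \<epsilon> :: "'g \<Rightarrow> 'g \<Rightarrow> 'f"
  assumes bracket_linear_left: "Vector_Spaces.linear scale scale (\<lambda>x. bracket x y)"
    and bracket_linear_right: "Vector_Spaces.linear scale scale (\<lambda>y. bracket x y)"
    and bracket_even: "x \<in> V \<alpha> \<Longrightarrow> y \<in> V \<beta> \<Longrightarrow> bracket x y \<in> V (\<alpha> + \<beta>)"
    and zeta_linear: "Vector_Spaces.linear scale scale \<zeta>"
    and zeta_even: "x \<in> V \<alpha> \<Longrightarrow> \<zeta> x \<in> V \<alpha>"
    and zeta_hom: "\<zeta> (bracket x y) = bracket (\<zeta> x) (\<zeta> y)"
    and bicharacter: "bicharacter \<epsilon>"
    and skew_symmetry: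
      "x \<in> V \<alpha> \<Longrightarrow> y \<in> V \<beta> \<Longrightarrow> bracket x y = - scale (\<epsilon> \<alpha> \<beta>) (bracket y x)"
    and hom_jacobi:
      "x \<in> V \<alpha> \<Longrightarrow> y \<in> V \<beta> \<Longrightarrow> z \<in> V \<gamma> \<Longrightarrow>
         scale (\<epsilon> \<gamma> \<alpha>) (bracket (\<zeta> x) (bracket y z)) +
         scale (\<epsilon> \<alpha> \<beta>) (bracket (\<zeta> y) (bracket z x)) +
         scale (\<epsilon> \<beta> \<gamma>) (bracket (\<zeta> z) (bracket x y)) = 0"

text \<open>The bilinear extension of \<open>(x, y) \<mapsto> \<sigma>(x, y)[x, y]\<close> from homogeneous to arbitrary elements.\<close>

definition twisted_bracket ::
    "('f \<Rightarrow> 'v \<Rightarrow> 'v) \<Rightarrow> ('g \<Rightarrow> 'v::ab_group_add set) \<Rightarrow> ('g \<Rightarrow> 'g \<Rightarrow> 'f) \<Rightarrow>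
     ('v \<Rightarrow> 'v \<Rightarrow> 'v) \<Rightarrow> 'v \<Rightarrow> 'v \<Rightarrow> 'v" where
  "twisted_bracket scale V \<sigma> bracket x y =
     (\<Sum>\<alpha>\<in>homogeneous_support V x. \<Sum>\<beta>\<in>homogeneous_support V y.
        scale (\<sigma> \<alpha> \<beta>) (bracket (homogeneous_component V x \<alpha>) (homogeneous_component V y \<beta>)))"

lemma (in graded_vector_space) homogeneous_component_homogeneous:
  assumes "x \<in> V \<alpha>"
  shows "homogeneous_component V x = (\<lambda>\<beta>. if \<beta> = \<alpha> then x else 0)"
proof -
  have "{\<beta>. (if \<beta> = \<alpha> then x else 0) \<noteq> 0} = (if x = 0 then {} else {\<alpha>})"
    by auto
  then have "homogeneous_decomposition V x (\<lambda>\<beta>. if \<beta> = \<alpha> then x else 0)"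
    unfolding homogeneous_decomposition_def
    using assms subspace_0[OF subspace_degree] by simp
  then show ?thesis
    unfolding homogeneous_component_def by (rule the1_equality[OF direct_sum])
qed

lemma (in hom_lie_color_algebra) twisted_bracket_homogeneous:
  assumes "x \<in> V \<alpha>" "y \<in> V \<beta>"
  shows "twisted_bracket scale V \<sigma> bracket x y = scale (\<sigma> \<alpha> \<beta>) (bracket x y)"
proof -
  interpret l: Vector_Spaces.linear scale scale "\<lambda>x. bracket x y"
    by (rule bracket_linear_left)
  interpret r: Vector_Spaces.linear scale scale "\<lambda>y. bracket x y"
    by (rule bracket_linear_right)
  have "homogeneous_support V x = (if x = 0 then {} else {\<alpha>})"
    and "homogeneous_support V y = (if y = 0 then {} else {\<beta>})"
    unfolding homogeneous_support_def homogeneous_component_homogeneous[OF assms(1)]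
      homogeneous_component_homogeneous[OF assms(2)] by auto
  then show ?thesis
    using l.zero r.zero
    by (auto simp: twisted_bracket_def homogeneous_component_homogeneous[OF assms(1)]
        homogeneous_component_homogeneous[OF assms(2)])
qed

end

theory Submission
  imports Defs
begin

text \<open>On homogeneous elements both sides of each axiom for the twist differ from the corresponding
  axiom for \<open>L\<close> by a common nonzero scalar. For the Hom-Jacobi identity this scalar is
  \<open>\<delta>(\<gamma>, \<alpha>) \<sigma>(\<alpha>, \<beta> + \<gamma>) \<sigma>(\<beta>, \<gamma>)\<close>, and the multiplier identity together with the commutativity of the
  grading group makes it invariant under cyclic permutations.\<close>

section \<open>Multipliers and their associated bi-characters\<close>

lemma multiplier_nonzero: "multiplier \<sigma> \<Longrightarrow> \<sigma> \<alpha> \<beta> \<noteq> 0"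
  by (simp add: multiplier_def)

lemma multiplier_cocycle:
  "multiplier \<sigma> \<Longrightarrow> \<sigma> \<alpha> (\<beta> + \<gamma>) * \<sigma> \<beta> \<gamma> = \<sigma> \<alpha> \<beta> * \<sigma> (\<alpha> + \<beta>) \<gamma>"
  by (simp add: multiplier_def)

lemma associated_bicharacter_inverse:
  assumes "multiplier \<sigma>"
  shows "associated_bicharacter \<sigma> \<alpha> \<beta> * associated_bicharacter \<sigma> \<beta> \<alpha> = 1"
  by (simp add: associated_bicharacter_def multiplier_nonzero[OF assms] field_simps)

text \<open>Three instances of the cocycle identity rewrite numerator and denominator of the
  left-hand quotient so that the factors \<open>\<sigma> (\<alpha> + \<beta>) \<gamma>\<close> and
  \<open>\<sigma> \<beta> \<gamma>\<close> cancel.\<close>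

lemma associated_bicharacter_add_right:
  assumes "multiplier \<sigma>"
  shows "associated_bicharacter \<sigma> \<alpha> (\<beta> + \<gamma>) =
    associated_bicharacter \<sigma> \<alpha> \<beta> * associated_bicharacter \<sigma> \<alpha> \<gamma>"
proof -
  note nz = multiplier_nonzero[OF assms]
  have 1: "\<sigma> \<alpha> (\<beta> + \<gamma>) = \<sigma> \<alpha> \<beta> * \<sigma> (\<alpha> + \<beta>) \<gamma> / \<sigma> \<beta> \<gamma>"
    using multiplier_cocycle[OF assms, of \<alpha> \<beta> \<gamma>] nz by (simp add: field_simps)
  have 2: "\<sigma> (\<beta> + \<gamma>) \<alpha> = \<sigma> \<beta> (\<gamma> + \<alpha>) * \<sigma> \<gamma> \<alpha> / \<sigma> \<beta> \<gamma>"
    using multiplier_cocycle[OF assms, of \<beta> \<gamma> \<alpha>] nz by (simp add: field_simps)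
  \<comment> \<open>Commutativity of the group enters here: the cocycle identity at
    \<open>\<beta>, \<alpha>, \<gamma>\<close> yields
    \<open>\<sigma> (\<beta> + \<alpha>) \<gamma>\<close>, which has to match the factor
    \<open>\<sigma> (\<alpha> + \<beta>) \<gamma>\<close> of the first equation.\<close>
  have 3: "\<sigma> \<beta> (\<gamma> + \<alpha>) = \<sigma> \<beta> \<alpha> * \<sigma> (\<alpha> + \<beta>) \<gamma> / \<sigma> \<alpha> \<gamma>"
    using multiplier_cocycle[OF assms, of \<beta> \<alpha> \<gamma>] nz by (simp add: field_simps add.commute)
  show ?thesis
    unfolding associated_bicharacter_def 1 2 3 using nz by (simp add: field_simps)
qed

text \<open>Exchanging the arguments inverts the value, so multiplicativity in the first argument
  follows from that in the second.\<close>

lemma bicharacter_associated_bicharacter: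
  assumes "multiplier \<sigma>"
  shows "bicharacter (associated_bicharacter \<sigma>)"
proof -
  have swap: "associated_bicharacter \<sigma> \<alpha> \<beta> = inverse (associated_bicharacter \<sigma> \<beta> \<alpha>)" for \<alpha> \<beta>
    by (simp add: associated_bicharacter_def)
  have "associated_bicharacter \<sigma> (\<alpha> + \<beta>) \<gamma> =
      associated_bicharacter \<sigma> \<alpha> \<gamma> * associated_bicharacter \<sigma> \<beta> \<gamma>" for \<alpha> \<beta> \<gamma>
    unfolding swap[of _ \<gamma>] associated_bicharacter_add_right[OF assms] by simp
  then show ?thesis
    unfolding bicharacter_def
    using associated_bicharacter_inverse[OF assms] associated_bicharacter_add_right[OF assms]
    by (auto simp: associated_bicharacter_def multiplier_nonzero[OF assms])
qed

lemma bicharacter_mult: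
  assumes "bicharacter \<epsilon>" "bicharacter \<delta>"
  shows "bicharacter (\<lambda>\<alpha> \<beta>. \<epsilon> \<alpha> \<beta> * \<delta> \<alpha> \<beta>)"
proof -
  have "\<epsilon> \<alpha> \<beta> * \<delta> \<alpha> \<beta> * (\<epsilon> \<beta> \<alpha> * \<delta> \<beta> \<alpha>) = (\<epsilon> \<alpha> \<beta> * \<epsilon> \<beta> \<alpha>) * (\<delta> \<alpha> \<beta> * \<delta> \<beta> \<alpha>)" for \<alpha> \<beta>
    by (simp only: ac_simps)
  then show ?thesis
    using assms unfolding bicharacter_def by simp
qed

text \<open>Splitting both \<open>\<sigma> \<alpha> (\<beta> + \<gamma>)\<close> and
  \<open>\<sigma> \<gamma> (\<alpha> + \<beta>)\<close> through the common factor
  \<open>\<sigma> (\<alpha> + \<gamma>) \<beta>\<close> reduces each side to \<open>\<sigma>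
  \<gamma> \<alpha> * \<sigma> (\<alpha> + \<gamma>) \<beta> * \<sigma> \<beta> \<gamma> / \<sigma>
  \<gamma> \<beta>\<close>.\<close>

lemma multiplier_jacobi_factor_cyclic:
  assumes "multiplier \<sigma>"
  shows "associated_bicharacter \<sigma> \<gamma> \<alpha> * \<sigma> \<alpha> (\<beta> + \<gamma>) * \<sigma> \<beta> \<gamma> =
    associated_bicharacter \<sigma> \<beta> \<gamma> * \<sigma> \<gamma> (\<alpha> + \<beta>) * \<sigma> \<alpha> \<beta>"
proof -
  note nz = multiplier_nonzero[OF assms]
  have 1: "\<sigma> \<alpha> (\<beta> + \<gamma>) = \<sigma> \<alpha> \<gamma> * \<sigma> (\<alpha> + \<gamma>) \<beta> / \<sigma> \<gamma> \<beta>"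
    using multiplier_cocycle[OF assms, of \<alpha> \<gamma> \<beta>] nz by (simp add: field_simps add.commute)
  have 2: "\<sigma> \<gamma> (\<alpha> + \<beta>) = \<sigma> \<gamma> \<alpha> * \<sigma> (\<alpha> + \<gamma>) \<beta> / \<sigma> \<alpha> \<beta>"
    using multiplier_cocycle[OF assms, of \<gamma> \<alpha> \<beta>] nz by (simp add: field_simps add.commute)
  show ?thesis
    unfolding associated_bicharacter_def 1 2 using nz by (simp add: field_simps)
qed

section \<open>Calculus of homogeneous components\<close>

context graded_vector_space
begin

lemma homogeneous_decomposition_component:
  "homogeneous_decomposition V x (homogeneous_component V x)"
  unfolding homogeneous_component_def by (rule theI'[OF direct_sum])

lemma homogeneous_component_in: "homogeneous_component V x \<alpha> \<in> V \<alpha>"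
  using homogeneous_decomposition_component by (simp add: homogeneous_decomposition_def)

lemma finite_homogeneous_support: "finite (homogeneous_support V x)"
  using homogeneous_decomposition_component
  by (simp add: homogeneous_decomposition_def homogeneous_support_def)

lemma homogeneous_component_eq_0: "\<alpha> \<notin> homogeneous_support V x \<Longrightarrow> homogeneous_component V x \<alpha> = 0"
  by (simp add: homogeneous_support_def)

lemma sum_homogeneous_component:
  assumes "finite A" "homogeneous_support V x \<subseteq> A"
  shows "(\<Sum>\<alpha>\<in>A. homogeneous_component V x \<alpha>) = x"
proof -
  have "x = sum (homogeneous_component V x) (homogeneous_support V x)"
    using homogeneous_decomposition_component
    by (simp add: homogeneous_decomposition_def homogeneous_support_def)
  also have "\<dots> = sum (homogeneous_component V x) A"
    by (rule sum.mono_neutral_left) (use assms homogeneous_component_eq_0 in auto)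
  finally show ?thesis by simp
qed

text \<open>Uniqueness of the decomposition reduces computing components to exhibiting a candidate
  \<open>c\<close>. The set \<open>A\<close> only has to enclose the support of \<open>c\<close>,
  which therefore need not be known exactly.\<close>

lemma homogeneous_component_eqI:
  assumes "\<And>\<alpha>. c \<alpha> \<in> V \<alpha>" "finite A" "\<And>\<alpha>. \<alpha> \<notin> A \<Longrightarrow> c \<alpha> = 0" "x = (\<Sum>\<alpha>\<in>A. c \<alpha>)"
  shows "homogeneous_component V x = c"
proof -
  have sub: "{\<alpha>. c \<alpha> \<noteq> 0} \<subseteq> A"
    using assms(3) by blast
  have "sum c A = (\<Sum>\<alpha> | c \<alpha> \<noteq> 0. c \<alpha>)"
    by (rule sum.mono_neutral_right) (use assms(2) sub in auto)
  then have "homogeneous_decomposition V x c"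
    unfolding homogeneous_decomposition_def
    using assms(1,4) finite_subset[OF sub assms(2)] by simp
  then show ?thesis
    unfolding homogeneous_component_def by (rule the1_equality[OF direct_sum])
qed

text \<open>Adding two decompositions gives a decomposition of the sum. Components may cancel, so
  the union of the supports serves only as an enclosing index set.\<close>

lemma homogeneous_component_add:
  "homogeneous_component V (x + y) =
    (\<lambda>\<alpha>. homogeneous_component V x \<alpha> + homogeneous_component V y \<alpha>)"
  by (rule homogeneous_component_eqI[where A = "homogeneous_support V x \<union> homogeneous_support V y"])
    (auto simp: subspace_add[OF subspace_degree] homogeneous_component_in finite_homogeneous_support
      homogeneous_component_eq_0 sum.distrib sum_homogeneous_component)

text \<open>Applying \<open>f\<close> to the decomposition of \<open>x\<close> leaves each summand
  in its degree, so uniqueness applies. The cases of interest are \<open>\<zeta>\<close> and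
  multiplication by a scalar.\<close>

lemma homogeneous_component_even_linear:
  assumes "Vector_Spaces.linear scale scale f" and "\<And>x \<alpha>. x \<in> V \<alpha> \<Longrightarrow> f x \<in> V \<alpha>"
  shows "homogeneous_component V (f x) = (\<lambda>\<alpha>. f (homogeneous_component V x \<alpha>))"
proof -
  interpret f: Vector_Spaces.linear scale scale f
    by (rule assms(1))
  show ?thesis
    by (rule homogeneous_component_eqI[where A = "homogeneous_support V x"])
      (simp_all add: assms(2) homogeneous_component_in finite_homogeneous_support
        homogeneous_component_eq_0 f.zero sum_homogeneous_component flip: f.sum)
qed

lemma homogeneous_component_scale:
  "homogeneous_component V (scale a x) = (\<lambda>\<alpha>. scale a (homogeneous_component V x \<alpha>))"
  by (rule homogeneous_component_even_linear)
    (simp_all add: linear_scale_self subspace_scale[OF subspace_degree])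

lemma homogeneous_support_add:
  "homogeneous_support V (x + y) \<subseteq> homogeneous_support V x \<union> homogeneous_support V y"
  by (auto simp: homogeneous_support_def homogeneous_component_add)

lemma homogeneous_support_scale: "homogeneous_support V (scale a x) \<subseteq> homogeneous_support V x"
  by (auto simp: homogeneous_support_def homogeneous_component_scale)

end

section \<open>The twisted bracket: bilinearity, compatibility with \<open>\<zeta>\<close>,
  skew-symmetry and Hom-Jacobi\<close>

context hom_lie_color_algebra
begin

sublocale bracket_left: Vector_Spaces.linear scale scale "\<lambda>x. bracket x y" for y
  by (rule bracket_linear_left)

sublocale bracket_right: Vector_Spaces.linear scale scale "\<lambda>y. bracket x y" for x
  by (rule bracket_linear_right)

sublocale zeta: Vector_Spaces.linear scale scale \<zeta>
  by (rule zeta_linear)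

text \<open>Indices outside the supports contribute brackets with a zero argument, hence nothing.
  This allows twisted brackets of elements with different supports to be compared over common index
  sets.\<close>

lemma twisted_bracket_superset:
  assumes "finite A" "homogeneous_support V x \<subseteq> A" "finite B" "homogeneous_support V y \<subseteq> B"
  shows "twisted_bracket scale V \<sigma> bracket x y =
    (\<Sum>\<alpha>\<in>A. \<Sum>\<beta>\<in>B.
      scale (\<sigma> \<alpha> \<beta>) (bracket (homogeneous_component V x \<alpha>) (homogeneous_component V y \<beta>)))"
proof -
  let ?t = "\<lambda>\<alpha> \<beta>. scale (\<sigma> \<alpha> \<beta>)
    (bracket (homogeneous_component V x \<alpha>) (homogeneous_component V y \<beta>))"
  have "(\<Sum>\<beta>\<in>homogeneous_support V y. ?t \<alpha> \<beta>) = (\<Sum>\<beta>\<in>B. ?t \<alpha> \<beta>)" for \<alpha>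
    by (rule sum.mono_neutral_left)
      (use assms in \<open>auto simp: homogeneous_component_eq_0 bracket_right.zero\<close>)
  moreover have "(\<Sum>\<alpha>\<in>homogeneous_support V x. \<Sum>\<beta>\<in>B. ?t \<alpha> \<beta>) = (\<Sum>\<alpha>\<in>A. \<Sum>\<beta>\<in>B. ?t \<alpha> \<beta>)"
    by (rule sum.mono_neutral_left)
      (use assms in \<open>auto simp: homogeneous_component_eq_0 bracket_left.zero\<close>)
  ultimately show ?thesis
    by (simp add: twisted_bracket_def)
qed

text \<open>Only an inclusion, since \<open>\<zeta>\<close> may annihilate components. It allows the
  twisted bracket of images to be summed over the supports of the original arguments.\<close>

lemma homogeneous_support_zeta: "homogeneous_support V (\<zeta> x) \<subseteq> homogeneous_support V x"
  by (auto simp: homogeneous_support_def zeta.zero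
      homogeneous_component_even_linear[OF zeta_linear zeta_even])

text \<open>The defining sum runs over a support that varies with \<open>x\<close>. Over a fixed
  index set (the union of the two supports for addition, the support of \<open>x\<close> for
  scaling) linearity holds term by term.\<close>

lemma twisted_bracket_linear_left:
  "Vector_Spaces.linear scale scale (\<lambda>x. twisted_bracket scale V \<sigma> bracket x y)"
proof (unfold Vector_Spaces.linear_iff, intro conjI allI vector_space_axioms)
  fix x x'
  let ?A = "homogeneous_support V x \<union> homogeneous_support V x'"
  note superset = twisted_bracket_superset[where A = ?A and B = "homogeneous_support V y"]
  show "twisted_bracket scale V \<sigma> bracket (x + x') y =
      twisted_bracket scale V \<sigma> bracket x y + twisted_bracket scale V \<sigma> bracket x' y"
    by (simp add: superset homogeneous_support_add finite_homogeneous_support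
        homogeneous_component_add bracket_left.add scale_right_distrib sum.distrib)
  fix a
  note superset = twisted_bracket_superset[where A = "homogeneous_support V x" and
      B = "homogeneous_support V y"]
  show "twisted_bracket scale V \<sigma> bracket (scale a x) y =
      scale a (twisted_bracket scale V \<sigma> bracket x y)"
    by (simp add: superset homogeneous_support_scale finite_homogeneous_support
        homogeneous_component_scale bracket_left.scale scale_sum_right mult.commute)
qed

lemma twisted_bracket_linear_right:
  "Vector_Spaces.linear scale scale (\<lambda>y. twisted_bracket scale V \<sigma> bracket x y)"
proof (unfold Vector_Spaces.linear_iff, intro conjI allI vector_space_axioms)
  fix y y'
  let ?B = "homogeneous_support V y \<union> homogeneous_support V y'"
  note superset = twisted_bracket_superset[where A = "homogeneous_support V x" and B = ?B]
  show "twisted_bracket scale V \<sigma> bracket x (y + y') =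
      twisted_bracket scale V \<sigma> bracket x y + twisted_bracket scale V \<sigma> bracket x y'"
    by (simp add: superset homogeneous_support_add finite_homogeneous_support
        homogeneous_component_add bracket_right.add scale_right_distrib sum.distrib)
  fix a
  note superset = twisted_bracket_superset[where A = "homogeneous_support V x" and
      B = "homogeneous_support V y"]
  show "twisted_bracket scale V \<sigma> bracket x (scale a y) =
      scale a (twisted_bracket scale V \<sigma> bracket x y)"
    by (simp add: superset homogeneous_support_scale finite_homogeneous_support
        homogeneous_component_scale bracket_right.scale scale_sum_right mult.commute)
qed

text \<open>The factor \<open>\<sigma> \<alpha> \<beta>\<close> depends only on degrees, which
  \<open>\<zeta>\<close> preserves, so both sides are the same double sum over the supports of
  \<open>x\<close> and \<open>y\<close>.\<close>

lemma zeta_twisted_bracket: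
  "\<zeta> (twisted_bracket scale V \<sigma> bracket x y) = twisted_bracket scale V \<sigma> bracket (\<zeta> x) (\<zeta> y)"
proof -
  note superset = twisted_bracket_superset[where A = "homogeneous_support V x" and
      B = "homogeneous_support V y"]
  show ?thesis
    by (simp add: superset homogeneous_support_zeta finite_homogeneous_support zeta.sum zeta.scale
        zeta_hom homogeneous_component_even_linear[OF zeta_linear zeta_even])
qed

text \<open>The twist factors of the two orders differ by exactly the associated bi-character:
  \<open>\<sigma> \<alpha> \<beta> = associated_bicharacter \<sigma> \<alpha> \<beta> * \<sigma>
  \<beta> \<alpha>\<close>.\<close>

lemma twisted_bracket_skew_symmetry:
  assumes "multiplier \<sigma>" "x \<in> V \<alpha>" "y \<in> V \<beta>"
  shows "twisted_bracket scale V \<sigma> bracket x y =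
    - scale (\<epsilon> \<alpha> \<beta> * associated_bicharacter \<sigma> \<alpha> \<beta>) (twisted_bracket scale V \<sigma> bracket y x)"
  unfolding twisted_bracket_homogeneous[OF assms(2,3)] twisted_bracket_homogeneous[OF assms(3,2)]
    skew_symmetry[OF assms(2,3)]
  by (simp add: associated_bicharacter_def multiplier_nonzero[OF assms(1)] mult.commute)

lemma twisted_bracket_hom_jacobi:
  assumes "multiplier \<sigma>" and x: "x \<in> V \<alpha>" and y: "y \<in> V \<beta>" and z: "z \<in> V \<gamma>"
  defines "T \<equiv> twisted_bracket scale V \<sigma> bracket"
    and "\<eta> \<equiv> \<lambda>\<alpha> \<beta>. \<epsilon> \<alpha> \<beta> * associated_bicharacter \<sigma> \<alpha> \<beta>"
  shows "scale (\<eta> \<gamma> \<alpha>) (T (\<zeta> x) (T y z)) + scale (\<eta> \<alpha> \<beta>) (T (\<zeta> y) (T z x)) +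
    scale (\<eta> \<beta> \<gamma>) (T (\<zeta> z) (T x y)) = 0"
proof -
  define K where "K \<alpha> \<beta> \<gamma> = associated_bicharacter \<sigma> \<gamma> \<alpha> * \<sigma> \<alpha> (\<beta> + \<gamma>) * \<sigma> \<beta> \<gamma>" for \<alpha> \<beta> \<gamma>
  have K: "K \<alpha> \<beta> \<gamma> = K \<gamma> \<alpha> \<beta>" for \<alpha> \<beta> \<gamma>
    unfolding K_def by (rule multiplier_jacobi_factor_cyclic[OF assms(1)])
  have jacobi_term: "scale (\<eta> \<gamma> \<alpha>) (T (\<zeta> x) (T y z)) =
      scale (K \<alpha> \<beta> \<gamma>) (scale (\<epsilon> \<gamma> \<alpha>) (bracket (\<zeta> x) (bracket y z)))"
    if "x \<in> V \<alpha>" "y \<in> V \<beta>" "z \<in> V \<gamma>" for x y z \<alpha> \<beta> \<gamma>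
  proof -
    have "T y z = scale (\<sigma> \<beta> \<gamma>) (bracket y z)"
      unfolding T_def using that(2,3) by (rule twisted_bracket_homogeneous)
    \<comment> \<open>The inner bracket has degree \<open>\<beta> + \<gamma>\<close> and
      \<open>\<zeta> x\<close> still has degree \<open>\<alpha>\<close>, so the outer bracket
      acquires the factor \<open>\<sigma> \<alpha> (\<beta> + \<gamma>)\<close>.\<close>
    moreover have "scale (\<sigma> \<beta> \<gamma>) (bracket y z) \<in> V (\<beta> + \<gamma>)"
      using that by (intro subspace_scale[OF subspace_degree] bracket_even)
    ultimately have "T (\<zeta> x) (T y z) =
        scale (\<sigma> \<alpha> (\<beta> + \<gamma>)) (bracket (\<zeta> x) (scale (\<sigma> \<beta> \<gamma>) (bracket y z)))"
      unfolding T_def using twisted_bracket_homogeneous[OF zeta_even[OF that(1)]] by simp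
    then show ?thesis
      by (simp add: \<eta>_def K_def bracket_right.scale ac_simps)
  qed
  \<comment> \<open>Cyclic invariance turns all three factors into
    \<open>K \<gamma> \<alpha> \<beta>\<close>. Keeping nested scalars unmerged lets this factor be
    pulled out of the sum, leaving the Hom-Jacobi expression of the original algebra.\<close>
  show ?thesis
    unfolding jacobi_term[OF x y z] jacobi_term[OF y z x] jacobi_term[OF z x y] K[of \<alpha> \<beta> \<gamma>] K[of \<beta> \<gamma> \<alpha>]
    by (simp add: hom_jacobi[OF x y z] K[of \<alpha> \<beta> \<gamma>] del: scale_scale flip: scale_right_distrib)
qed

end

theorem proposition4p23:
  fixes scale :: "'f::field_char_0 \<Rightarrow> 'v::ab_group_add \<Rightarrow> 'v"
    and V :: "'g::ab_group_add \<Rightarrow> 'v set"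
    and bracket :: "'v \<Rightarrow> 'v \<Rightarrow> 'v"
    and \<zeta> :: "'v \<Rightarrow> 'v"
    and \<epsilon> \<sigma> :: "'g \<Rightarrow> 'g \<Rightarrow> 'f"
  assumes "hom_lie_color_algebra scale V bracket \<zeta> \<epsilon>"
    and "multiplier \<sigma>"
  shows "hom_lie_color_algebra scale V (twisted_bracket scale V \<sigma> bracket) \<zeta>
           (\<lambda>\<alpha> \<beta>. \<epsilon> \<alpha> \<beta> * associated_bicharacter \<sigma> \<alpha> \<beta>)"
proof -
  interpret L: hom_lie_color_algebra scale V bracket \<zeta> \<epsilon>
    by (rule assms(1))
  show ?thesis
  proof (intro hom_lie_color_algebra.intro hom_lie_color_algebra_axioms.intro)
    \<comment> \<open>Evenness is checked directly: on homogeneous arguments the twist is a scalar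
      multiple of the original bracket, and each degree is a subspace.\<close>
    fix x y \<alpha> \<beta>
    assume "x \<in> V \<alpha>" "y \<in> V \<beta>"
    then show "twisted_bracket scale V \<sigma> bracket x y \<in> V (\<alpha> + \<beta>)"
      by (simp add: L.twisted_bracket_homogeneous L.bracket_even
          L.subspace_scale[OF L.subspace_degree])
  qed (rule L.graded_vector_space_axioms L.twisted_bracket_linear_left L.twisted_bracket_linear_right
      L.zeta_linear L.zeta_even L.zeta_twisted_bracket
      bicharacter_mult[OF L.bicharacter bicharacter_associated_bicharacter[OF assms(2)]]
      L.twisted_bracket_skew_symmetry[OF assms(2)] L.twisted_bracket_hom_jacobi[OF assms(2)];
      assumption)+
qed

end
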